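(* Let $T_A$ be a discrete weighted torus (of any dimension $n\ge1$) satisfying the distance condition. Then its total curvature is non-positive: $\sum_{[x]\in T_A}R([x])\le 0$. Furthermore, if $R([x])\ge 0$ for all $[x]\in T_A$, then $R([x])=0$ for all $[x]\in T_A$.
   Context: **Weighted graphs and curvature.** A weighted graph is a locally finite, simple, undirected, connected graph with positive symmetric edge weights $w$; all vertex weights are $1$. Write $x\sim y$ for neighbours; $d$ is the combinatorial graph distance, $B_R(x)=\{y: d(x,y)\le R\}$. The Laplacian is $\Delta f(x)=\sum_{y\sim x}w(x,y)(f(y)-f(x))$. For $x\neq y$ put $\nabla_{xy}f=\frac{f(x)-f(y)}{d(x,y)}$. The Ollivier curvature is $\kappa(x,y)=\inf\nabla_{xy}\Delta f$, the infimum over all $f:B_1(x)\cup B_1(y)\to\mathbb{R}$ that are $1$-Lipschitz with respect to $d$ and satisfy $\nabla_{yx}f=1$. The scalar curvature is $R(x)=\sum_{y\sim x}\kappa(x,y)$. **Discrete torus.** Let $A=[\alpha_1,\dots,\alpha_n]$ be an $n\times n$ integer matrix with columns $\alpha_i$ and $\det A\ne0$, let $k$ be a positive integer and $q=k|\det A|$ (so $q\mathbb{Z}^n\subset A\mathbb{Z}^n$). Regard $A\mathbb{Z}^n$ as a graph with $x\sim y$ iff $x-y=\pm\alpha_i$ for some $i$. The discrete torus is the quotient $T_A=A\mathbb{Z}^n/q\mathbb{Z}^n$, with $[x]\sim[y]$ iff $x-y\in q\mathbb{Z}^n\pm\alpha_i$ for some $i$. It carries positive symmetric edge weights, and for $x\sim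 y$ in $A\mathbb{Z}^n$ the weights are related by $w([x],[y])=w(x,y)$. The total curvature of $T_A$ is $\sum_{[x]\in T_A}R([x])$. **Distance condition.** For every $x\in A\mathbb{Z}^n$ and all $u,v\in B_2(x)\subset A\mathbb{Z}^n$, $d(u,v)=d([u],[v])$, where the left side is the graph distance in $A\mathbb{Z}^n$ and the right side the graph distance in $T_A$. *)

theory Defs
  imports "HOL-Analysis.Analysis"
begin

record 'a wgraph =
  verts :: "'a set"
  adj :: "'a \<Rightarrow> 'a \<Rightarrow> bool"
  wt :: "'a \<Rightarrow> 'a \<Rightarrow> real"

text \<open>The fields \<open>adj\<close> and \<open>wt\<close> are only meaningful on vertices and on edges, respectively.\<close>

definition nbrs :: "'a wgraph \<Rightarrow> 'a \<Rightarrow> 'a set" where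
  "nbrs G x = {y \<in> verts G. adj G x y}"

definition edges :: "'a wgraph \<Rightarrow> ('a \<times> 'a) set" where
  "edges G = {(x, y). x \<in> verts G \<and> y \<in> nbrs G x}"

definition weighted_graph :: "'a wgraph \<Rightarrow> bool" where
  "weighted_graph G \<longleftrightarrow>
     (\<forall>x\<in>verts G. finite (nbrs G x)) \<and>
     (\<forall>x\<in>verts G. x \<notin> nbrs G x) \<and>
     (\<forall>x\<in>verts G. \<forall>y\<in>nbrs G x. x \<in> nbrs G y) \<and>
     (\<forall>x\<in>verts G. \<forall>y\<in>verts G. (x, y) \<in> (edges G)\<^sup>*) \<and>
     (\<forall>x\<in>verts G. \<forall>y\<in>nbrs G x. wt G x y > 0 \<and> wt G x y = wt G y x)"

text \<open>\<open>(x, y) \<in> edges G ^^ n\<close> says that there is a walk with \<open>n\<close> edges from \<open>x\<close> to \<open>y\<close>.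
  In a connected graph the \<open>LEAST\<close> ranges over a nonempty set, so it is the length of a
  shortest path.\<close>

definition gdist :: "'a wgraph \<Rightarrow> 'a \<Rightarrow> 'a \<Rightarrow> nat" where
  "gdist G x y = (LEAST n. (x, y) \<in> edges G ^^ n)"

definition gball :: "'a wgraph \<Rightarrow> nat \<Rightarrow> 'a \<Rightarrow> 'a set" where
  "gball G r x = {y \<in> verts G. gdist G x y \<le> r}"

definition laplacian :: "'a wgraph \<Rightarrow> ('a \<Rightarrow> real) \<Rightarrow> 'a \<Rightarrow> real" where
  "laplacian G f x = (\<Sum>y\<in>nbrs G x. wt G x y * (f y - f x))"

definition grad :: "'a wgraph \<Rightarrow> 'a \<Rightarrow> 'a \<Rightarrow> ('a \<Rightarrow> real) \<Rightarrow> real" where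
  "grad G x y f = (f x - f y) / real (gdist G x y)"

definition lipschitz1_on :: "'a wgraph \<Rightarrow> 'a set \<Rightarrow> ('a \<Rightarrow> real) \<Rightarrow> bool" where
  "lipschitz1_on G S f \<longleftrightarrow> (\<forall>u\<in>S. \<forall>v\<in>S. \<bar>f u - f v\<bar> \<le> real (gdist G u v))"

text \<open>The test functions are total, but only their values on \<open>gball G 1 x \<union> gball G 1 y\<close>
  matter: the Laplacian at \<open>x\<close> and at \<open>y\<close> looks at no other vertices. In a locally finite
  connected graph and for \<open>x \<noteq> y\<close> the set below is nonempty (take \<open>f = gdist G x\<close>) and
  bounded below, so that the real-valued \<open>Inf\<close> is the true infimum.\<close>

definition ollivier_curvature :: "'a wgraph \<Rightarrow> 'a \<Rightarrow> 'a \<Rightarrow> real" where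
  "ollivier_curvature G x y =
     Inf {grad G x y (laplacian G f) | f.
            lipschitz1_on G (gball G 1 x \<union> gball G 1 y) f \<and> grad G y x f = 1}"

definition scalar_curvature :: "'a wgraph \<Rightarrow> 'a \<Rightarrow> real" where
  "scalar_curvature G x = (\<Sum>y\<in>nbrs G x. ollivier_curvature G x y)"

definition total_curvature :: "'a wgraph \<Rightarrow> real" where
  "total_curvature G = (\<Sum>x\<in>verts G. scalar_curvature G x)"

definition lattice :: "int^'n^'n \<Rightarrow> (int^'n) set" where
  "lattice A = range (\<lambda>z. A *v z)"

definition lattice_graph ::
  "int^'n^'n \<Rightarrow> (int^'n \<Rightarrow> int^'n \<Rightarrow> real) \<Rightarrow> (int^'n) wgraph" where
  "lattice_graph A w =
     \<lparr>verts = lattice A,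
      adj = (\<lambda>x y. \<exists>i. x - y = column i A \<or> x - y = - column i A),
      wt = w\<rparr>"

definition torus_modulus :: "int^'n^'n \<Rightarrow> nat \<Rightarrow> int" where
  "torus_modulus A k = int k * \<bar>det A\<bar>"

definition torus_rel :: "int^'n^'n \<Rightarrow> nat \<Rightarrow> (int^'n) rel" where
  "torus_rel A k =
     {(x, y). x \<in> lattice A \<and> y \<in> lattice A \<and> (\<exists>z. x - y = torus_modulus A k *s z)}"

definition torus_class :: "int^'n^'n \<Rightarrow> nat \<Rightarrow> int^'n \<Rightarrow> (int^'n) set" where
  "torus_class A k x = torus_rel A k `` {x}"

definition torus_graph ::
  "int^'n^'n \<Rightarrow> nat \<Rightarrow> ((int^'n) set \<Rightarrow> (int^'n) set \<Rightarrow> real) \<Rightarrow> (int^'n) set wgraph" where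
  "torus_graph A k W =
     \<lparr>verts = lattice A // torus_rel A k,
      adj = (\<lambda>X Y. \<exists>x\<in>X. \<exists>y\<in>Y. \<exists>i z.
               x - y = torus_modulus A k *s z + column i A \<or>
               x - y = torus_modulus A k *s z - column i A),
      wt = W\<rparr>"

definition distance_condition ::
  "int^'n^'n \<Rightarrow> nat \<Rightarrow> (int^'n \<Rightarrow> int^'n \<Rightarrow> real) \<Rightarrow>
     ((int^'n) set \<Rightarrow> (int^'n) set \<Rightarrow> real) \<Rightarrow> bool" where
  "distance_condition A k w W \<longleftrightarrow>
     (\<forall>x\<in>lattice A.
        \<forall>u\<in>gball (lattice_graph A w) 2 x. \<forall>v\<in>gball (lattice_graph A w) 2 x.
          gdist (lattice_graph A w) u v =
          gdist (torus_graph A k W) (torus_class A k u) (torus_class A k v))"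

text \<open>The objects above are what they are meant to be: lattice and torus are weighted graphs
  (the torus has no loops because of the distance condition), and the torus is finite, so that
  \<open>total_curvature\<close> is a genuine finite sum.\<close>

lemma scale_vec_simps:
  fixes z z' :: "int^'n"
  shows "c *s (- z) = - (c *s z)" and "c *s (z + z') = c *s z + c *s z'"
    and "c *s (z - z') = c *s z - c *s z'" and "c *s (0 :: int^'n) = 0"
  by (simp_all add: vec_eq_iff algebra_simps)

lemma lattice_0: "0 \<in> lattice A"
  unfolding lattice_def by (metis matrix_vector_mult_0_right rangeI)

lemma lattice_add: "x \<in> lattice A \<Longrightarrow> y \<in> lattice A \<Longrightarrow> x + y \<in> lattice A"
  unfolding lattice_def by (auto simp: image_iff) (metis matrix_vector_right_distrib)

lemma lattice_diff: "x \<in> lattice A \<Longrightarrow> y \<in> lattice A \<Longrightarrow> x - y \<in> lattice A"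
  unfolding lattice_def by (auto simp: image_iff) (metis matrix_vector_mult_diff_distrib)

lemma lattice_column: "column i (A :: int^'n^'n) \<in> lattice A"
proof -
  have "A *v axis i 1 = column i A"
    by (simp add: matrix_vector_mult_def column_def axis_def vec_eq_iff if_distrib cong: if_cong)
  thus ?thesis unfolding lattice_def by (metis rangeI)
qed

lemma column_nz:
  fixes A :: "int^'n^'n"
  assumes "det A \<noteq> 0"
  shows "column i A \<noteq> 0"
proof
  assume z: "column i A = 0"
  have "(\<Prod>j\<in>UNIV. A $ j $ p j) = 0" if "p permutes UNIV" for p
  proof -
    have "p (inv p i) = i" using permutes_inverses(1)[OF that] by simp
    then obtain j where "p j = i" by blast
    moreover have "A $ j $ i = 0" using z by (simp add: column_def vec_eq_iff)
    ultimately show ?thesis by (auto intro!: prod_zero)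
  qed
  hence "det A = 0" unfolding det_def by (intro sum.neutral) auto
  thus False using assms by simp
qed

lemma edges_lattice_graph:
  "(x, y) \<in> edges (lattice_graph A w) \<longleftrightarrow>
     x \<in> lattice A \<and> y \<in> lattice A \<and> (\<exists>i. x - y = column i A \<or> x - y = - column i A)"
  by (simp add: edges_def nbrs_def lattice_graph_def)

lemma lattice_graph_connected:
  assumes x: "x \<in> lattice A" and y: "y \<in> lattice A"
  shows "(x, y) \<in> (edges (lattice_graph A w))\<^sup>*"
proof -
  let ?E = "edges (lattice_graph A w)"
  have symE: "sym ?E"
    by (rule symI) (auto simp: edges_lattice_graph, (metis minus_diff_eq minus_minus)+)
  have nat_step: "(u, u + int m *s column i A) \<in> ?E\<^sup>* \<and> u + int m *s column i A \<in> lattice A"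
    if u: "u \<in> lattice A" for u m i
  proof (induction m)
    case 0 show ?case using u by simp
  next
    case (Suc m)
    have eq: "u + int (Suc m) *s column i A = (u + int m *s column i A) + column i A"
      by (simp add: vec_eq_iff algebra_simps)
    define v where "v = u + int m *s column i A"
    have v: "v \<in> lattice A" using Suc by (simp add: v_def)
    have v': "v + column i A \<in> lattice A" by (rule lattice_add[OF v lattice_column])
    have "v - (v + column i A) = - column i A" by simp
    hence "(v, v + column i A) \<in> ?E" unfolding edges_lattice_graph using v v' by blast
    thus ?case using Suc v' unfolding eq v_def[symmetric]
      by (blast intro: rtrancl.rtrancl_into_rtrancl)
  qed
  have column_mult: "int m *s column i A \<in> lattice A" for m i
    using nat_step[OF lattice_0, of m i] by simp
  have step: "(u, u + c *s column i A) \<in> ?E\<^sup>* \<and> u + c *s column i A \<in> lattice A"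
    if u: "u \<in> lattice A" for u c i
  proof (cases "c \<ge> 0")
    case True
    thus ?thesis using nat_step[OF u, of "nat c" i] by simp
  next
    case False
    define m where "m = nat (- c)"
    have c: "c = - int m" using False by (simp add: m_def)
    have eq: "u + c *s column i A = u - int m *s column i A"
      by (simp add: c vec_eq_iff)
    have L: "u - int m *s column i A \<in> lattice A"
      by (rule lattice_diff[OF u column_mult])
    have "(u - int m *s column i A, u) \<in> ?E\<^sup>*"
      using nat_step[OF L, of m i] by simp
    thus ?thesis using L eq symE by (metis sym_rtrancl symD)
  qed
  have sum_step: "(u, u + (\<Sum>i\<in>S. c i *s column i A)) \<in> ?E\<^sup>* \<and>
      u + (\<Sum>i\<in>S. c i *s column i A) \<in> lattice A"
    if "finite S" "u \<in> lattice A" for S u c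
    using that
  proof (induction S)
    case (insert i S)
    let ?v = "u + (\<Sum>i\<in>S. c i *s column i A)"
    have "(u, ?v) \<in> ?E\<^sup>*" "?v \<in> lattice A" using insert by auto
    moreover have "(?v, ?v + c i *s column i A) \<in> ?E\<^sup>* \<and> ?v + c i *s column i A \<in> lattice A"
      by (rule step) fact
    moreover have "?v + c i *s column i A = u + (\<Sum>i\<in>insert i S. c i *s column i A)"
      using insert by (simp add: algebra_simps)
    ultimately show ?case using rtrancl_trans[of u ?v ?E] by simp
  qed simp
  obtain z where z: "y - x = A *v z"
    using lattice_diff[OF y x] by (auto simp: lattice_def)
  have "y = x + (\<Sum>i\<in>UNIV. z $ i *s column i A)"
    using z matrix_mult_sum[of A z] by (simp add: algebra_simps)
  thus ?thesis using sum_step[OF finite x] by metis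
qed

lemma torus_rel_iff:
  "(x, y) \<in> torus_rel A k \<longleftrightarrow>
     x \<in> lattice A \<and> y \<in> lattice A \<and> (\<exists>z. x - y = torus_modulus A k *s z)"
  by (simp add: torus_rel_def)

lemma equiv_torus_rel: "equiv (lattice A) (torus_rel A k)"
proof (rule equivI)
  let ?q = "torus_modulus A k"
  show "torus_rel A k \<subseteq> lattice A \<times> lattice A" by (auto simp: torus_rel_def)
  show "refl_on (lattice A) (torus_rel A k)"
    by (auto simp: refl_on_def torus_rel_iff scale_vec_simps intro!: exI[of _ 0])
  show "sym (torus_rel A k)"
  proof (rule symI)
    fix x y assume "(x, y) \<in> torus_rel A k"
    then obtain z where "x \<in> lattice A" "y \<in> lattice A" "x - y = ?q *s z"
      by (auto simp: torus_rel_iff)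
    moreover from this have "y - x = ?q *s (- z)"
      by (metis minus_diff_eq scale_vec_simps(1))
    ultimately show "(y, x) \<in> torus_rel A k" unfolding torus_rel_iff by metis
  qed
  show "trans (torus_rel A k)"
  proof (rule transI)
    fix x y u assume "(x, y) \<in> torus_rel A k" "(y, u) \<in> torus_rel A k"
    then obtain z z' where "x \<in> lattice A" "u \<in> lattice A" "x - y = ?q *s z" "y - u = ?q *s z'"
      by (auto simp: torus_rel_iff)
    moreover from this have "x - u = ?q *s (z + z')"
      by (metis scale_vec_simps(2) diff_add_cancel add_diff_eq)
    ultimately show "(x, u) \<in> torus_rel A k" unfolding torus_rel_iff by metis
  qed
qed

lemma edges_torus_graph:
  assumes "x \<in> lattice A" "y \<in> lattice A"
  shows "(torus_class A k x, torus_class A k y) \<in> edges (torus_graph A k W) \<longleftrightarrow>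
     (\<exists>i z. x - y = torus_modulus A k *s z + column i A \<or>
            x - y = torus_modulus A k *s z - column i A)" (is "?l \<longleftrightarrow> ?r")
proof
  let ?q = "torus_modulus A k"
  assume ?l
  then obtain x' y' i z where *: "(x, x') \<in> torus_rel A k" "(y, y') \<in> torus_rel A k"
    and d: "x' - y' = ?q *s z + column i A \<or> x' - y' = ?q *s z - column i A"
    by (auto simp: edges_def nbrs_def torus_graph_def torus_class_def)
  obtain a b where ab: "x - x' = ?q *s a" "y - y' = ?q *s b"
    using * by (auto simp: torus_rel_iff)
  have "x - y = (x - x') - (y - y') + (x' - y')" by simp
  also have "\<dots> = ?q *s (a - b) + (x' - y')"
    unfolding ab by (simp add: scale_vec_simps)
  finally have "x - y = ?q *s (a - b + z) + column i A \<or> x - y = ?q *s (a - b + z) - column i A"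
    using d by (auto simp: scale_vec_simps)
  thus ?r by blast
next
  have "x \<in> torus_class A k x" "y \<in> torus_class A k y"
    using assms equiv_class_self[OF equiv_torus_rel] by (auto simp: torus_class_def)
  moreover assume ?r
  ultimately show ?l
    using assms by (auto simp: edges_def nbrs_def torus_graph_def torus_class_def quotientI)
qed

lemma verts_torus_graph: "verts (torus_graph A k W) = torus_class A k ` lattice A"
  by (auto simp: torus_graph_def torus_class_def quotient_def)

lemma finite_torus:
  fixes A :: "int^'n^'n"
  assumes "det A \<noteq> 0" "k > 0"
  shows "finite (verts (torus_graph A k W))"
proof -
  let ?q = "torus_modulus A k"
  have q: "?q > 0" using assms by (simp add: torus_modulus_def)
  define r :: "int^'n \<Rightarrow> int^'n" where "r x = (\<chi> i. x $ i mod ?q)" for x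
  have "r ` lattice A \<subseteq> vec_lambda ` (UNIV \<rightarrow>\<^sub>E {0..<?q})"
    using q by (force simp: r_def image_iff PiE_def extensional_def)
  hence fin: "finite (r ` lattice A)"
    by (rule finite_subset) (simp add: finite_PiE)
  have "torus_class A k x = torus_class A k y"
    if "x \<in> lattice A" "y \<in> lattice A" "r x = r y" for x y
  proof -
    have "x $ i - y $ i = ?q * ((x $ i - y $ i) div ?q)" for i
    proof -
      have "x $ i mod ?q = y $ i mod ?q" using that(3) by (simp add: r_def vec_eq_iff)
      thus ?thesis by (simp add: mod_eq_dvd_iff)
    qed
    hence "x - y = ?q *s (\<chi> i. (x $ i - y $ i) div ?q)" by (simp add: vec_eq_iff)
    hence "(x, y) \<in> torus_rel A k" using that by (auto simp: torus_rel_iff)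
    thus ?thesis
      unfolding torus_class_def using equiv_class_eq[OF equiv_torus_rel] by blast
  qed
  hence "torus_class A k x = torus_class A k (inv_into (lattice A) r (r x))"
    if "x \<in> lattice A" for x
    using that by (metis f_inv_into_f imageI inv_into_into)
  hence "torus_class A k ` lattice A \<subseteq>
      (\<lambda>s. torus_class A k (inv_into (lattice A) r s)) ` r ` lattice A"
    by blast
  thus ?thesis
    using fin by (simp add: verts_torus_graph finite_subset)
qed

theorem weighted_graph_lattice_graph:
  fixes A :: "int^'n^'n"
  assumes "det A \<noteq> 0"
    and "\<And>x y. (x, y) \<in> edges (lattice_graph A w) \<Longrightarrow> w x y > 0 \<and> w x y = w y x"
  shows "weighted_graph (lattice_graph A w)"
proof -
  let ?G = "lattice_graph A w"
  have nb: "y \<in> nbrs ?G x \<longleftrightarrow> (x, y) \<in> edges ?G" if "x \<in> verts ?G" for x y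
    using that by (simp add: edges_def)
  have fin: "finite (nbrs ?G x)" for x
  proof -
    have "nbrs ?G x \<subseteq> range (\<lambda>i. x - column i A) \<union> range (\<lambda>i. x + column i A)"
      by (auto simp: nbrs_def lattice_graph_def image_iff algebra_simps)
    thus ?thesis by (rule finite_subset) simp
  qed
  have sym: "(y, x) \<in> edges ?G" if "(x, y) \<in> edges ?G" for x y
    using that by (auto simp: edges_lattice_graph, (metis minus_diff_eq minus_minus)+)
  have irr: "(x, x) \<notin> edges ?G" for x
    using column_nz[OF assms(1)] by (auto simp: edges_lattice_graph)
  have V: "x \<in> verts ?G \<and> y \<in> verts ?G" if "(x, y) \<in> edges ?G" for x y
    using that by (auto simp: edges_def nbrs_def)
  have "wt ?G = w" "verts ?G = lattice A" by (simp_all add: lattice_graph_def)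
  thus ?thesis
    unfolding weighted_graph_def
    by (intro conjI ballI) (use fin irr sym nb V assms(2) lattice_graph_connected in auto)
qed

theorem weighted_graph_torus_graph:
  fixes A :: "int^'n^'n"
  assumes "det A \<noteq> 0" and "k > 0"
    and W: "\<And>X Y. (X, Y) \<in> edges (torus_graph A k W) \<Longrightarrow> W X Y > 0 \<and> W X Y = W Y X"
    and dc: "distance_condition A k w W"
  shows "weighted_graph (torus_graph A k W)"
proof -
  let ?G = "torus_graph A k W" and ?L = "lattice_graph A w"
  let ?q = "torus_modulus A k" and ?c = "torus_class A k"
  have nb: "Y \<in> nbrs ?G X \<longleftrightarrow> (X, Y) \<in> edges ?G" if "X \<in> verts ?G" for X Y
    using that by (simp add: edges_def)
  have V: "X \<in> verts ?G \<and> Y \<in> verts ?G" if "(X, Y) \<in> edges ?G" for X Y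
    using that by (auto simp: edges_def nbrs_def)
  have fin: "finite (nbrs ?G X)" for X
    by (rule finite_subset[OF _ finite_torus[OF assms(1,2)]]) (auto simp: nbrs_def)
  have sym: "(Y, X) \<in> edges ?G" if E: "(X, Y) \<in> edges ?G" for X Y
  proof -
    obtain x y where xy: "x \<in> lattice A" "y \<in> lattice A" "X = ?c x" "Y = ?c y"
      using V[OF E] by (auto simp: verts_torus_graph)
    obtain i z where "x - y = ?q *s z + column i A \<or> x - y = ?q *s z - column i A"
      using E edges_torus_graph[OF xy(1,2)] by (auto simp: xy)
    moreover have "y - x = - (x - y)" by simp
    ultimately have "y - x = ?q *s (- z) - column i A \<or> y - x = ?q *s (- z) + column i A"
      by (metis scale_vec_simps(1) minus_add_distrib minus_diff_eq diff_minus_eq_add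
          uminus_add_conv_diff add.commute)
    thus ?thesis unfolding xy edges_torus_graph[OF xy(2,1)] by blast
  qed
  have irr: "(X, X) \<notin> edges ?G" for X
  proof
    assume E: "(X, X) \<in> edges ?G"
    obtain x where x: "x \<in> lattice A" "X = ?c x"
      using V[OF E] by (auto simp: verts_torus_graph)
    obtain i z where "x - x = ?q *s z + column i A \<or> x - x = ?q *s z - column i A"
      using E edges_torus_graph[OF x(1,1)] by (auto simp: x)
    hence "\<exists>z. column i A = ?q *s z"
    proof
      assume "x - x = ?q *s z + column i A"
      hence "column i A = - (?q *s z)" by (metis diff_self add_eq_0_iff)
      hence "column i A = ?q *s (- z)" by (simp only: scale_vec_simps)
      thus ?thesis by blast
    next
      assume "x - x = ?q *s z - column i A"
      thus ?thesis by (metis diff_self eq_iff_diff_eq_0)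
    qed
    hence "(column i A, 0) \<in> torus_rel A k"
      by (auto simp: torus_rel_iff lattice_0 lattice_column)
    hence cl: "?c 0 = ?c (column i A)"
      unfolding torus_class_def using equiv_class_eq[OF equiv_torus_rel] by blast
    have g0: "gdist H v v = 0" for H :: "'z wgraph" and v
      unfolding gdist_def by (rule Least_eq_0) simp
    have e: "(0, column i A) \<in> edges ?L"
      by (auto simp: edges_lattice_graph lattice_0 lattice_column)
    have le: "gdist ?L 0 (column i A) \<le> 1"
      unfolding gdist_def by (rule Least_le) (use e in simp)
    have b: "0 \<in> gball ?L 2 0" "column i A \<in> gball ?L 2 0"
      using le by (auto simp: gball_def g0 lattice_graph_def lattice_0 lattice_column)
    have "gdist ?L 0 (column i A) = gdist ?G (?c 0) (?c (column i A))"
      using dc b lattice_0 unfolding distance_condition_def by blast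
    hence "gdist ?L 0 (column i A) = 0" using cl g0[of ?G] by (simp add: gdist_def)
    moreover have "(0, column i A) \<in> edges ?L ^^ gdist ?L 0 (column i A)"
      unfolding gdist_def by (rule LeastI[of _ 1]) (use e in simp)
    ultimately show False using column_nz[OF assms(1), of i] by simp
  qed
  have conn: "(X, Y) \<in> (edges ?G)\<^sup>*" if "X \<in> verts ?G" "Y \<in> verts ?G" for X Y
  proof -
    obtain x y where xy: "x \<in> lattice A" "y \<in> lattice A" "X = ?c x" "Y = ?c y"
      using \<open>X \<in> verts ?G\<close> \<open>Y \<in> verts ?G\<close> by (auto simp: verts_torus_graph)
    have "(x, y) \<in> (edges ?L)\<^sup>*" by (rule lattice_graph_connected) fact+
    hence "(?c x, ?c y) \<in> (edges ?G)\<^sup>*"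
    proof (induction rule: rtrancl_induct)
      case (step y z)
      obtain i where "y \<in> lattice A" "z \<in> lattice A" "y - z = column i A \<or> y - z = - column i A"
        using step(2) by (auto simp: edges_lattice_graph)
      hence "(?c y, ?c z) \<in> edges ?G"
        by (subst edges_torus_graph) (auto simp: scale_vec_simps intro!: exI[of _ i] exI[of _ 0])
      thus ?case using step by (meson rtrancl.rtrancl_into_rtrancl)
    qed simp
    thus ?thesis by (simp add: xy)
  qed
  have "wt ?G = W" by (simp add: torus_graph_def)
  thus ?thesis
    unfolding weighted_graph_def
    by (intro conjI ballI) (use fin irr sym nb V W conn in auto)
qed

end

theory Submission
  imports Defs
begin

text \<open>For a generator \<open>a = \<plusminus>\<alpha>\<^sub>i\<close> the \<open>i\<close>-th coordinate function of the lattice, with the sign of \<open>a\<close>,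
  descends to a test function near the edge from \<open>[x]\<close> to \<open>[x + a]\<close> by the distance condition. It
  bounds the curvature of this edge by \<open>b\<^sub>a x - b\<^sub>a (x + a)\<close>, where
  \<open>b\<^sub>a x = w(x, x + a) - w(x, x - a)\<close>. Summed over the torus, this bound telescopes to zero for every
  \<open>a\<close>. If all scalar curvatures are nonnegative, their sum can only be nonpositive
  if all of them vanish.\<close>

section \<open>Graph distance and upper bounds on the curvature in a weighted graph\<close>

lemma gdist_self [simp]: "gdist G x x = 0"
  unfolding gdist_def by (rule Least_eq_0) simp

lemma gdist_le_1: "(x, y) \<in> edges G \<Longrightarrow> gdist G x y \<le> 1"
  unfolding gdist_def by (rule Least_le) simp

lemma relpow_gdist: "(x, y) \<in> (edges G)\<^sup>* \<Longrightarrow> (x, y) \<in> edges G ^^ gdist G x y"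
  unfolding gdist_def by (rule LeastI_ex) (simp add: rtrancl_power)

lemma gdist_eq_0_iff: "(x, y) \<in> (edges G)\<^sup>* \<Longrightarrow> gdist G x y = 0 \<longleftrightarrow> x = y"
  using relpow_gdist[of x y G] by auto

lemma gdist_nbr:
  assumes "weighted_graph G" "x \<in> verts G" "y \<in> nbrs G x"
  shows "gdist G x y = 1"
proof -
  have "(x, y) \<in> edges G" using assms by (simp add: edges_def)
  moreover have "x \<noteq> y" using assms by (auto simp: weighted_graph_def)
  ultimately show ?thesis
    using gdist_le_1[of x y G] gdist_eq_0_iff[of x y G] by (simp add: r_into_rtrancl le_Suc_eq)
qed

lemma gball_1:
  assumes "weighted_graph G" "x \<in> verts G"
  shows "gball G 1 x = insert x (nbrs G x)"
proof -
  have "y = x \<or> y \<in> nbrs G x" if "y \<in> verts G" "gdist G x y \<le> 1" for y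
  proof -
    have "(x, y) \<in> edges G ^^ gdist G x y"
      using assms that by (intro relpow_gdist) (auto simp: weighted_graph_def)
    thus ?thesis using that(2) by (auto simp: le_Suc_eq edges_def)
  qed
  thus ?thesis using assms gdist_nbr[OF assms] by (auto simp: gball_def nbrs_def)
qed

lemma lipschitz1_on_subset: "lipschitz1_on G S f \<Longrightarrow> S' \<subseteq> S \<Longrightarrow> lipschitz1_on G S' f"
  unfolding lipschitz1_on_def by blast

text \<open>A 1-Lipschitz function changes by at most 1 along an edge. The bound does not depend on
  \<open>f\<close>, as is required for bounding the curvature infimum from below.\<close>

lemma abs_laplacian_le:
  assumes G: "weighted_graph G" and x: "x \<in> verts G"
    and f: "lipschitz1_on G S f" and S: "gball G 1 x \<subseteq> S"
  shows "\<bar>laplacian G f x\<bar> \<le> (\<Sum>y\<in>nbrs G x. wt G x y)"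
proof -
  have "\<bar>wt G x y * (f y - f x)\<bar> \<le> wt G x y" if y: "y \<in> nbrs G x" for y
  proof -
    have "x \<in> nbrs G y" "y \<in> verts G" "wt G x y > 0"
      using G x y by (auto simp: weighted_graph_def nbrs_def)
    moreover have "x \<in> S" "y \<in> S" using S gball_1[OF G x] y by auto
    ultimately have "\<bar>f y - f x\<bar> \<le> 1"
      using f gdist_nbr[OF G, of y x] by (force simp: lipschitz1_on_def)
    thus ?thesis using \<open>wt G x y > 0\<close> by (simp add: abs_mult)
  qed
  thus ?thesis unfolding laplacian_def
    by (intro order_trans[OF sum_abs] sum_mono)
qed

text \<open>A single admissible test function bounds the infimum from above. As \<open>x\<close> and
  \<open>y\<close> are at distance 1, gradients along this edge are plain differences.\<close>

lemma ollivier_curvature_le: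
  assumes G: "weighted_graph G" and x: "x \<in> verts G" and y: "y \<in> nbrs G x"
    and f: "lipschitz1_on G (gball G 1 x \<union> gball G 1 y) f" "f y - f x = 1"
  shows "ollivier_curvature G x y \<le> laplacian G f x - laplacian G f y"
proof -
  let ?S = "gball G 1 x \<union> gball G 1 y"
  have yv: "y \<in> verts G" "x \<in> nbrs G y"
    using G x y by (auto simp: weighted_graph_def nbrs_def)
  note d = gdist_nbr[OF G x y] gdist_nbr[OF G yv]
  \<comment> \<open>The real-valued \<open>Inf\<close> is only guaranteed to lie below the members
    of the set if the set is bounded below.\<close>
  have "bdd_below {grad G x y (laplacian G f) | f. lipschitz1_on G ?S f \<and> grad G y x f = 1}"
  proof (rule bdd_belowI)
    fix t assume "t \<in> {grad G x y (laplacian G f) | f. lipschitz1_on G ?S f \<and> grad G y x f = 1}"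
    then obtain g where g: "lipschitz1_on G ?S g" "t = laplacian G g x - laplacian G g y"
      by (auto simp: grad_def d)
    show "- (\<Sum>z\<in>nbrs G x. wt G x z) - (\<Sum>z\<in>nbrs G y. wt G y z) \<le> t"
      using abs_laplacian_le[OF G x g(1)] abs_laplacian_le[OF G yv(1) g(1)] g(2) by auto
  qed
  thus ?thesis unfolding ollivier_curvature_def
    by (rule cInf_lower[rotated]) (use f in \<open>auto simp: grad_def d intro!: exI[of _ f]\<close>)
qed

section \<open>Generators of the lattice and their coordinate functions\<close>

definition generators :: "int^'n^'n \<Rightarrow> (int^'n) set" where
  "generators A = range (\<lambda>i. column i A) \<union> range (\<lambda>i. - column i A)"

lemma finite_generators [simp]: "finite (generators A)"
  by (simp add: generators_def)

lemma generators_uminus: "a \<in> generators A \<Longrightarrow> - a \<in> generators A"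
  by (auto simp: generators_def)

lemma generators_lattice: "a \<in> generators A \<Longrightarrow> a \<in> lattice A"
  using lattice_diff[OF lattice_0 lattice_column] lattice_column by (auto simp: generators_def)

text \<open>By Cramer's rule, the \<open>i\<close>-th coordinate with respect to the columns of \<open>A\<close> is the determinant
  of \<open>A\<close> with column \<open>i\<close> replaced, divided by \<open>det A\<close>; the matrix below is transposed.\<close>

lemma coordinate_functional:
  fixes A :: "int^'n^'n"
  assumes det: "det A \<noteq> 0"
  shows "\<exists>\<phi> :: int^'n \<Rightarrow> real.
    Modules.additive \<phi> \<and> (\<forall>j. \<phi> (column j A) = (if j = i then 1 else 0))"
proof -
  define D :: "int^'n \<Rightarrow> int" where "D x = det (\<chi> r. if r = i then x else column r A)" for x
  define \<phi> where "\<phi> x = real_of_int (D x) / real_of_int (det A)" for x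
  have "D (x + y) = D x + D y" for x y
    unfolding D_def by (rule det_row_add)
  hence "Modules.additive \<phi>" by unfold_locales (simp add: \<phi>_def add_divide_distrib)
  moreover have "D (column j A) = (if j = i then det A else 0)" for j
  proof (cases "j = i")
    case True
    have "(\<chi> r. if r = i then column i A else column r A) = transpose A"
      by (simp add: vec_eq_iff transpose_def column_def)
    thus ?thesis using True by (simp add: D_def)
  next
    case False
    have "D (column j A) = 0" unfolding D_def
      by (rule det_identical_rows[OF False]) (use False in \<open>simp add: row_def vec_eq_iff\<close>)
    thus ?thesis using False by simp
  qed
  ultimately show ?thesis using det by (intro exI[of _ \<phi>]) (auto simp: \<phi>_def)
qed

text \<open>A suitable coordinate function takes the value 1 or -1 at \<open>a\<close>; multiplying
  it by this value makes \<open>\<phi> a = 1\<close>. Generators other than \<open>a\<close> and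
  \<open>- a\<close> come from other columns, where it vanishes.\<close>

lemma generator_functional:
  fixes A :: "int^'n^'n"
  assumes det: "det A \<noteq> 0" and a: "a \<in> generators A"
  shows "\<exists>\<phi> :: int^'n \<Rightarrow> real. Modules.additive \<phi> \<and> \<phi> a = 1 \<and>
    (\<forall>b\<in>generators A - {a, - a}. \<phi> b = 0)"
proof -
  obtain i where i: "a = column i A \<or> a = - column i A" using a by (auto simp: generators_def)
  obtain \<psi> :: "int^'n \<Rightarrow> real" where \<psi>: "Modules.additive \<psi> \<and>
      (\<forall>j. \<psi> (column j A) = (if j = i then 1 else 0))"
    using coordinate_functional[OF det, of i] ..
  interpret \<psi>: additive \<psi> using \<psi> ..
  have c: "\<psi> (column j A) = (if j = i then 1 else 0)" for j using \<psi> by simp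
  define \<phi> where "\<phi> x = \<psi> a * \<psi> x" for x
  have "Modules.additive \<phi>" by unfold_locales (simp add: \<phi>_def \<psi>.add algebra_simps)
  moreover have "\<phi> a = 1" using i by (auto simp: \<phi>_def \<psi>.minus c)
  moreover have "\<phi> b = 0" if "b \<in> generators A - {a, - a}" for b
    using that i by (auto simp: \<phi>_def \<psi>.minus c generators_def split: if_splits)
  ultimately show ?thesis by (intro exI[of _ \<phi>]) simp
qed

section \<open>Local comparison of the torus with the lattice\<close>

locale discrete_torus =
  fixes A :: "int^'n^'n" and k :: nat
    and w :: "int^'n \<Rightarrow> int^'n \<Rightarrow> real"
    and W :: "(int^'n) set \<Rightarrow> (int^'n) set \<Rightarrow> real"
  assumes det: "det A \<noteq> 0" and k: "k > 0"
    and W: "\<And>X Y. (X, Y) \<in> edges (torus_graph A k W) \<Longrightarrow> W X Y > 0 \<and> W X Y = W Y X"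
    and dc: "distance_condition A k w W"
begin

abbreviation "L \<equiv> lattice_graph A w"
abbreviation "T \<equiv> torus_graph A k W"
abbreviation "cls \<equiv> torus_class A k"

lemma weighted_T: "weighted_graph T"
  using weighted_graph_torus_graph[OF det k W dc] .

lemma cls_verts: "x \<in> lattice A \<Longrightarrow> cls x \<in> verts T"
  by (simp add: verts_torus_graph)

lemma cls_eq_iff:
  assumes "x \<in> lattice A" "y \<in> lattice A"
  shows "cls x = cls y \<longleftrightarrow> (\<exists>z. x - y = torus_modulus A k *s z)"
  using eq_equiv_class_iff[OF equiv_torus_rel assms] assms
  by (simp add: torus_class_def torus_rel_iff)

lemma cls_add_eq_iff:
  assumes "x \<in> lattice A" "y \<in> lattice A" "a \<in> lattice A"
  shows "cls (x + a) = cls (y + a) \<longleftrightarrow> cls x = cls y"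
  using assms by (simp add: cls_eq_iff lattice_add)

lemma edges_L: "(x, y) \<in> edges L \<longleftrightarrow> x \<in> lattice A \<and> (\<exists>a\<in>generators A. y = x + a)"
proof -
  have *: "(\<exists>a\<in>generators A. y = x + a) \<longleftrightarrow> (\<exists>i. x - y = column i A \<or> x - y = - column i A)"
    unfolding generators_def bex_Un bex_simps by (auto simp: algebra_simps)
  show ?thesis
    unfolding edges_lattice_graph *[symmetric] using lattice_add generators_lattice by blast
qed

lemma nbrs_T:
  assumes x: "x \<in> lattice A"
  shows "nbrs T (cls x) = (\<lambda>a. cls (x + a)) ` generators A"
proof (intro set_eqI iffI)
  fix Y assume Y: "Y \<in> nbrs T (cls x)"
  then obtain y where y: "y \<in> lattice A" "Y = cls y" by (auto simp: nbrs_def verts_torus_graph)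
  have "(cls x, cls y) \<in> edges T" using Y y cls_verts[OF x] by (simp add: edges_def)
  then obtain i z where
    *: "x - y = torus_modulus A k *s z + column i A \<or> x - y = torus_modulus A k *s z - column i A"
    by (auto simp: edges_torus_graph[OF x y(1)])
  hence "\<exists>a\<in>generators A. x + a - y = torus_modulus A k *s z"
  proof
    assume "x - y = torus_modulus A k *s z + column i A"
    hence "x + (- column i A) - y = torus_modulus A k *s z" by (simp add: algebra_simps)
    thus ?thesis by (rule bexI) (simp add: generators_def)
  next
    assume "x - y = torus_modulus A k *s z - column i A"
    hence "x + column i A - y = torus_modulus A k *s z" by (simp add: algebra_simps)
    thus ?thesis by (rule bexI) (simp add: generators_def)
  qed
  then obtain a where a: "a \<in> generators A" "x + a - y = torus_modulus A k *s z" by blast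
  hence "cls (x + a) = cls y"
    using cls_eq_iff[of "x + a" y] x y by (auto simp: lattice_add generators_lattice)
  thus "Y \<in> (\<lambda>a. cls (x + a)) ` generators A" using y a by auto
next
  fix Y assume "Y \<in> (\<lambda>a. cls (x + a)) ` generators A"
  then obtain a where a: "a \<in> generators A" "Y = cls (x + a)" by blast
  have "(cls x, cls (x + a)) \<in> edges T"
    unfolding edges_torus_graph[OF x lattice_add[OF x generators_lattice[OF a(1)]]]
    using a(1) by (auto simp: generators_def scale_vec_simps intro!: exI[of _ 0])
  thus "Y \<in> nbrs T (cls x)" using a by (simp add: edges_def)
qed

text \<open>With \<open>0\<close> allowed as a step, this covers all lattice points needed later:
  \<open>x\<close>, \<open>x + a\<close> and the neighbours of both. They fit into the radius 2 of
  the distance condition.\<close>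

lemma gball_2:
  assumes x: "x \<in> lattice A" and a: "a \<in> insert 0 (generators A)" and b: "b \<in> insert 0 (generators A)"
  shows "x + a + b \<in> gball L 2 x"
proof -
  have step: "gdist L x (y + c) \<le> Suc n \<and> y + c \<in> lattice A \<and> (x, y + c) \<in> (edges L)\<^sup>*"
    if "gdist L x y \<le> n" "y \<in> lattice A" "(x, y) \<in> (edges L)\<^sup>*" "c \<in> insert 0 (generators A)" for y c n
  proof (cases "c = 0")
    case False
    hence e: "(y, y + c) \<in> edges L" using that by (auto simp: edges_L)
    have "(x, y + c) \<in> edges L ^^ Suc (gdist L x y)"
      using relpow_gdist[OF that(3)] e by auto
    hence "gdist L x (y + c) \<le> Suc (gdist L x y)" unfolding gdist_def by (rule Least_le)
    thus ?thesis using that e False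
      by (auto intro: rtrancl_into_rtrancl simp: lattice_add generators_lattice)
  qed (use that in auto)
  have "gdist L x (x + a) \<le> Suc 0 \<and> x + a \<in> lattice A \<and> (x, x + a) \<in> (edges L)\<^sup>*"
    by (rule step) (use x a in auto)
  hence "gdist L x (x + a + b) \<le> Suc (Suc 0) \<and> x + a + b \<in> lattice A"
    using step[of "x + a" "Suc 0" b] b by blast
  thus ?thesis by (simp add: gball_def lattice_graph_def numeral_2_eq_2)
qed

lemma gball_2_lattice: "u \<in> gball L r x \<Longrightarrow> u \<in> lattice A"
  by (simp add: gball_def lattice_graph_def)

lemma gdist_cls:
  assumes "x \<in> lattice A" "u \<in> gball L 2 x" "v \<in> gball L 2 x"
  shows "gdist T (cls u) (cls v) = gdist L u v"
  using dc assms unfolding distance_condition_def by simp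

text \<open>Equal classes are at torus distance 0, hence their representatives in the ball are at
  lattice distance 0.\<close>

lemma inj_on_cls:
  assumes x: "x \<in> lattice A"
  shows "inj_on cls (gball L 2 x)"
proof (rule inj_onI)
  fix u v assume uv: "u \<in> gball L 2 x" "v \<in> gball L 2 x" "cls u = cls v"
  hence "gdist L u v = 0" using gdist_cls[OF x uv(1,2)] by simp
  thus "u = v"
    using gdist_eq_0_iff[OF lattice_graph_connected] uv gball_2_lattice by blast
qed

text \<open>Distinct generators lead to distinct torus neighbours, since all \<open>x + a\<close>
  lie in a ball on which \<open>cls\<close> is injective. The new index set no longer depends on the
  vertex.\<close>

lemma sum_nbrs_T:
  assumes x: "x \<in> lattice A"
  shows "sum g (nbrs T (cls x)) = (\<Sum>a\<in>generators A. g (cls (x + a)))"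
proof -
  have "inj_on (\<lambda>a. cls (x + a)) (generators A)"
  proof (rule inj_onI)
    fix a b assume ab: "a \<in> generators A" "b \<in> generators A" "cls (x + a) = cls (x + b)"
    have "x + a \<in> gball L 2 x" "x + b \<in> gball L 2 x"
      using gball_2[OF x, of 0] ab by simp_all
    thus "a = b" using inj_onD[OF inj_on_cls[OF x] ab(3)] by simp
  qed
  thus ?thesis by (simp add: nbrs_T[OF x] sum.reindex)
qed

section \<open>Curvature bound from coordinate functions\<close>

definition drift :: "int^'n \<Rightarrow> int^'n \<Rightarrow> real" where
  "drift a x = W (cls x) (cls (x + a)) - W (cls x) (cls (x - a))"

text \<open>The test function is the coordinate in direction \<open>a\<close>, carried to the torus
  by a local inverse of \<open>cls\<close>. It rises by 1 from \<open>x\<close> to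
  \<open>x + a\<close>, and its Laplacian at each end is the drift there.\<close>

lemma curvature_le_drift:
  assumes x: "x \<in> lattice A" and a: "a \<in> generators A"
  shows "ollivier_curvature T (cls x) (cls (x + a)) \<le> drift a x - drift a (x + a)"
proof -
  obtain \<phi> :: "int^'n \<Rightarrow> real" where \<phi>: "Modules.additive \<phi> \<and> \<phi> a = 1 \<and>
      (\<forall>b\<in>generators A - {a, - a}. \<phi> b = 0)"
    using generator_functional[OF det a] ..
  interpret \<phi>: additive \<phi> using \<phi> ..
  have \<phi>a: "\<phi> a = 1" and \<phi>0: "b \<in> generators A \<Longrightarrow> b \<noteq> a \<Longrightarrow> b \<noteq> - a \<Longrightarrow> \<phi> b = 0" for b
    using \<phi> by simp_all
  have \<phi>b: "\<bar>\<phi> b\<bar> \<le> 1" if b: "b \<in> generators A" for b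
  proof -
    have "\<phi> b = 1 \<or> \<phi> b = - 1 \<or> \<phi> b = 0"
      using \<phi>0[OF b] by (metis \<phi>.minus \<phi>a)
    thus ?thesis by auto
  qed
  \<comment> \<open>Each lattice edge changes \<open>\<phi>\<close> by at most 1, so
    \<open>\<phi>\<close> is 1-Lipschitz for the lattice distance.\<close>
  have walk: "\<bar>\<phi> u - \<phi> v\<bar> \<le> real n" if "(u, v) \<in> edges L ^^ n" for u v n
    using that
  proof (induction n arbitrary: v)
    case (Suc n)
    then obtain y b where "(u, y) \<in> edges L ^^ n" "b \<in> generators A" "v = y + b"
      by (auto simp: edges_L)
    thus ?case using Suc.IH[of y] \<phi>b[of b] by (auto simp: \<phi>.add)
  qed simp
  let ?B = "gball L 2 x"
  \<comment> \<open>\<open>\<phi>\<close> does not descend to the whole torus, so classes are lifted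
    to \<open>?B\<close> only; the values of \<open>f\<close> outside the image of \<open>?B\<close>
    never matter.\<close>
  define f where "f X = \<phi> (inv_into ?B cls X)" for X
  have f: "f (cls u) = \<phi> u" if "u \<in> ?B" for u
    using that by (simp add: f_def inv_into_f_f[OF inj_on_cls[OF x]])
  have xa: "x + a \<in> lattice A" by (rule lattice_add[OF x generators_lattice[OF a]])
  have balls: "gball T 1 (cls x) \<union> gball T 1 (cls (x + a)) \<subseteq> cls ` ?B"
  proof -
    \<comment> \<open>Both ends of the edge are treated at once, as \<open>b = 0\<close> and
      \<open>b = a\<close>.\<close>
    have "gball T 1 (cls (x + b)) \<subseteq> cls ` ?B"
      if b: "b \<in> insert 0 (generators A)" and xb: "x + b \<in> lattice A" for b
      unfolding gball_1[OF weighted_T cls_verts[OF xb]] nbrs_T[OF xb]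
      using gball_2[OF x b, of 0] gball_2[OF x b] by auto
    from this[of 0] this[of a] show ?thesis using x xa a by simp
  qed
  have "lipschitz1_on T (cls ` ?B) f"
    unfolding lipschitz1_on_def
  proof (intro ballI; elim imageE; hypsubst)
    fix u v assume uv: "u \<in> ?B" "v \<in> ?B"
    \<comment> \<open>A shortest lattice walk bounds the difference by the lattice distance, which
      equals the torus distance on \<open>?B\<close>.\<close>
    have "(u, v) \<in> edges L ^^ gdist L u v"
      by (intro relpow_gdist lattice_graph_connected uv[THEN gball_2_lattice])
    thus "\<bar>f (cls u) - f (cls v)\<bar> \<le> real (gdist T (cls u) (cls v))"
      using walk[of u v "gdist L u v"] by (simp add: f uv gdist_cls[OF x])
  qed
  hence lip: "lipschitz1_on T (gball T 1 (cls x) \<union> gball T 1 (cls (x + a))) f"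
    by (rule lipschitz1_on_subset[OF _ balls])
  have lap: "laplacian T f (cls y) = drift a y"
    if y: "y \<in> lattice A" "y \<in> ?B" "\<And>b. b \<in> generators A \<Longrightarrow> y + b \<in> ?B" for y
  proof -
    have "\<phi> a \<noteq> \<phi> (- a)" by (simp add: \<phi>a \<phi>.minus)
    \<comment> \<open>Needed for the sum over \<open>{a, - a}\<close> to have two terms.\<close>
    hence ne: "a \<noteq> - a" by metis
    \<comment> \<open>By additivity the increment of \<open>f\<close> along \<open>b\<close> is
      \<open>\<phi> b\<close>, whatever the point \<open>y\<close>.\<close>
    have "laplacian T f (cls y) = (\<Sum>b\<in>generators A. W (cls y) (cls (y + b)) * \<phi> b)"
      unfolding laplacian_def sum_nbrs_T[OF y(1)]
      by (intro sum.cong) (simp_all add: f y \<phi>.add torus_graph_def)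
    also have "\<dots> = (\<Sum>b\<in>{a, - a}. W (cls y) (cls (y + b)) * \<phi> b)"
      by (rule sum.mono_neutral_right) (use a generators_uminus[OF a] \<phi>0 in auto)
    also have "\<dots> = drift a y" using ne by (simp add: drift_def \<phi>a \<phi>.minus)
    finally show ?thesis .
  qed
  have B: "x + b + c \<in> ?B" if "b \<in> insert 0 (generators A)" "c \<in> insert 0 (generators A)" for b c
    using gball_2[OF x that] .
  have "f (cls (x + a)) - f (cls x) = 1"
    using B[of 0 0] B[of a 0] a by (simp add: f \<phi>.add \<phi>a)
  moreover have "cls (x + a) \<in> nbrs T (cls x)" using a by (auto simp: nbrs_T[OF x])
  moreover have "laplacian T f (cls x) = drift a x"
    by (rule lap[OF x]) (use B[of 0 0] B[of 0] in auto)
  moreover have "laplacian T f (cls (x + a)) = drift a (x + a)"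
    by (rule lap[OF xa]) (use B[of a 0] B[of a] a in auto)
  ultimately show ?thesis
    using ollivier_curvature_le[OF weighted_T cls_verts[OF x] _ lip] by simp
qed

section \<open>Summation over the torus\<close>

definition rep :: "(int^'n) set \<Rightarrow> int^'n" where
  "rep = inv_into (lattice A) cls"

lemma rep:
  assumes "X \<in> verts T"
  shows "rep X \<in> lattice A" "cls (rep X) = X"
  using assms by (auto simp: rep_def verts_torus_graph inv_into_into f_inv_into_f)

text \<open>The weights in \<open>drift\<close> are taken between classes, and translation respects
  classes. Hence the choice made by \<open>rep\<close> does not affect the sums below.\<close>

lemma drift_cong:
  assumes "x \<in> lattice A" "y \<in> lattice A" "cls x = cls y" "a \<in> generators A"
  shows "drift a x = drift a y"
proof -
  have "cls (x + b) = cls (y + b)" if b: "b \<in> generators A" for b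
    using assms that by (simp add: cls_add_eq_iff generators_lattice)
  from this[of a] this[of "- a"] show ?thesis
    using assms(3,4) generators_uminus[OF assms(4)] by (simp add: drift_def)
qed

text \<open>Translation by \<open>a\<close> permutes the torus, and \<open>rep (\<sigma> X)\<close>
  and \<open>rep X + a\<close> represent the same class, so they have the same drift.\<close>

lemma sum_drift_shift:
  assumes a: "a \<in> generators A"
  shows "(\<Sum>X\<in>verts T. drift a (rep X + a)) = (\<Sum>X\<in>verts T. drift a (rep X))"
proof -
  define \<sigma> where "\<sigma> X = cls (rep X + a)" for X
  have al: "a \<in> lattice A" using a by (rule generators_lattice)
  have fin: "finite (verts T)" by (rule finite_torus[OF det k])
  have \<sigma>: "\<sigma> X \<in> verts T" if "X \<in> verts T" for X
    unfolding \<sigma>_def by (intro cls_verts lattice_add rep that al)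
  have "inj_on \<sigma> (verts T)"
    by (rule inj_onI) (metis \<sigma>_def cls_add_eq_iff al rep)
  \<comment> \<open>An injective self-map of a finite set is surjective.\<close>
  moreover from this have "\<sigma> ` verts T = verts T"
    using \<sigma> fin by (intro card_subset_eq) (auto simp: card_image)
  ultimately have "(\<Sum>X\<in>verts T. drift a (rep X)) = (\<Sum>X\<in>verts T. drift a (rep (\<sigma> X)))"
    using sum.reindex[of \<sigma> "verts T" "\<lambda>X. drift a (rep X)"] by simp
  also have "\<dots> = (\<Sum>X\<in>verts T. drift a (rep X + a))"
  proof (rule sum.cong)
    fix X assume X: "X \<in> verts T"
    show "drift a (rep (\<sigma> X)) = drift a (rep X + a)"
      using rep[OF \<sigma>[OF X]] rep(1)[OF X] al
      by (intro drift_cong a) (simp_all add: \<sigma>_def lattice_add)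
  qed simp
  finally show ?thesis by simp
qed

text \<open>Exchanging the sums groups the oriented edges by generator; within each group the drifts
  at the two ends have equal sums and cancel.\<close>

lemma total_curvature_nonpos: "total_curvature T \<le> 0"
proof -
  have "total_curvature T =
      (\<Sum>X\<in>verts T. \<Sum>a\<in>generators A. ollivier_curvature T X (cls (rep X + a)))"
    unfolding total_curvature_def
  proof (rule sum.cong)
    fix X assume "X \<in> verts T"
    thus "scalar_curvature T X = (\<Sum>a\<in>generators A. ollivier_curvature T X (cls (rep X + a)))"
      using sum_nbrs_T[of "rep X"] by (simp add: scalar_curvature_def rep)
  qed simp
  also have "\<dots> = (\<Sum>a\<in>generators A. \<Sum>X\<in>verts T. ollivier_curvature T X (cls (rep X + a)))"
    by (rule sum.swap)
  also have "\<dots> \<le> (\<Sum>a\<in>generators A. \<Sum>X\<in>verts T. drift a (rep X) - drift a (rep X + a))"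
  proof (intro sum_mono)
    fix a X assume "a \<in> generators A" "X \<in> verts T"
    thus "ollivier_curvature T X (cls (rep X + a)) \<le> drift a (rep X) - drift a (rep X + a)"
      using curvature_le_drift[of "rep X" a] by (simp add: rep)
  qed
  also have "\<dots> = 0" by (simp add: sum_subtractf sum_drift_shift)
  finally show ?thesis .
qed

end

theorem theorem1p8:
  fixes A :: "int^'n^'n"
    and k :: nat
    and w :: "int^'n \<Rightarrow> int^'n \<Rightarrow> real"
    and W :: "(int^'n) set \<Rightarrow> (int^'n) set \<Rightarrow> real"
  assumes "det A \<noteq> 0"
    and "k > 0"
    and "\<And>X Y. (X, Y) \<in> edges (torus_graph A k W) \<Longrightarrow> W X Y > 0 \<and> W X Y = W Y X"
    and "\<And>x y. (x, y) \<in> edges (lattice_graph A w) \<Longrightarrow>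
           W (torus_class A k x) (torus_class A k y) = w x y"
    and "distance_condition A k w W"
  shows "total_curvature (torus_graph A k W) \<le> 0 \<and>
    ((\<forall>X\<in>verts (torus_graph A k W). scalar_curvature (torus_graph A k W) X \<ge> 0) \<longrightarrow>
     (\<forall>X\<in>verts (torus_graph A k W). scalar_curvature (torus_graph A k W) X = 0))"
proof -
  let ?T = "torus_graph A k W"
  interpret discrete_torus A k w W by unfold_locales (fact assms)+
  have "scalar_curvature ?T X = 0"
    if nonneg: "\<forall>X\<in>verts ?T. scalar_curvature ?T X \<ge> 0" and X: "X \<in> verts ?T" for X
  proof -
    have "total_curvature ?T \<ge> 0" unfolding total_curvature_def by (rule sum_nonneg) (use nonneg in auto)
    hence "total_curvature ?T = 0" using total_curvature_nonpos by linarith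
    thus ?thesis
      using sum_nonneg_eq_0_iff[OF finite_torus[OF assms(1,2)]] nonneg X
      unfolding total_curvature_def by blast
  qed
  thus ?thesis using total_curvature_nonpos by blast
qed

end
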